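(* Assume the setting and Assumptions (A1)–(A4) described in the context. Let $L\in\mathbb{N}$ and $M_1,\dots,M_L\in\mathbb{N}$ (positive integers). Then the inexact multilevel Monte Carlo Galerkin approximation $E^L[\tilde u_L]=\sum_{l=1}^L E_{M_l}[\tilde u_l-\tilde u_{l-1}]$ of the expected value $\mathbb{E}[u]$ satisfies the error estimate $$\|\mathbb{E}[u]-E^L[\tilde u_L]\|_{L^2(\Omega;H)}^2\le 3M_1^{-1}\Big(\tfrac14 Tol_1^2+V[u]\Big)+\tfrac12\Big(1+(1+q^{-1})^2\sum_{l=2}^L M_l^{-1}q^{2(l-L)}\Big)Tol^2 .$$
   Context: Let $(\Omega,\mathcal{A},\mathbb{P})$ be a complete probability space and $H$ a separable real Hilbert space with scalar product $(\cdot,\cdot)_H$, norm $\|\cdot\|_H$ and dual $H'$. $L^2(\Omega;H)$ is the Bochner space of measurable $v:\Omega\to H$ with $\|v\|_{L^2(\Omega;H)}^2=\int_\Omega\|v(\omega)\|_H^2\,d\mathbb{P}(\omega)<\infty$, and $\mathbb{E}[v]=\int_\Omega v\,d\mathbb{P}\in H$. Put $V[v]=\mathbb{E}[\|\mathbb{E}[v]-v\|_H^2]$. Let $a(\omega;\cdot,\cdot)$ be bilinear forms and $\ell(\omega;\cdot)$ linear functionals on $H$, $\omega\in\Omega$, and $K\subset H$. (A1) $K$ is non-empty, closed and convex. For each $\omega$, $\ell(\omega;\cdot)\in H'$, and $\gamma(\omega)\|v\|_H^2\le a(\omega;v,v)$, $a(\omega;v,w)\le\Gamma(\omega)\|v\|_H\|w\|_H$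 for all $v,w\in H$, with $\gamma(\omega)\ge\gamma_0>0$ a.e. in $\Omega$ for a constant $\gamma_0$ and $\Gamma\in L^\infty(\Omega)$. For all fixed $v,w\in H$ the maps $a(\cdot;v,w)$ and $\ell(\cdot;v)$ are measurable, and $\ell\in L^2(\Omega;H')$. Under (A1), for each $\omega$ there is a unique solution $u(\omega)\in K$ of $a(\omega;u(\omega),v-u(\omega))\ge\ell(\omega;v-u(\omega))$ for all $v\in K$, and $u\in L^2(\Omega;H)$. Tolerances: $0<Tol_1<1$, $0<q<1$, $Tol_l=q\,Tol_{l-1}$ for $l=2,\dots,L$, and $Tol=Tol_L$. For each $\omega\in\Omega$ let $S_1(\omega)\subset S_2(\omega)\subset\cdots\subset S_L(\omega)\subset H$ be finite-dimensional subspaces with dimensions $N_l(\omega)$, and let $K_l(\omega)\subset S_l(\omega)$ be non-empty, closed, convex subsets. (A2) For all $l=1,\dots,L$ the set-valued map $\omega\mapsto K_l(\omega)\subset H$ is measurable (in the usual sense for closed-valued maps) and there is $w_l\in L^2(\Omega;H)$ with $w_l(\omega)\in K_l(\omega)$ for all $\omega\in\Omega$. Under (A1) and (A2), for each $l$ and $\omega$ there is a unique $u_l(\omega)\in K_l(\omega)$ with $a(\omega;u_l(\omega),v-u_l(\omega))\ge\ell(\omega;v-u_l(\omega))$ for all $v\in K_l(\omega)$, and $u_l\in L^2(\Omega;H)$. (A3) For all $l=1,\dots,L$: $\|u-u_l\|_{L^2(\Omega;H)}\le\frac{1}{2\sqrt2}Tol_l$. (A4) For all $l=1,\dots,L$ and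 each $\omega\in\Omega$, an approximation $\tilde u_l(\omega)\in S_l(\omega)$ of $u_l(\omega)$ is given with $\|u_l(\omega)-\tilde u_l(\omega)\|_H\le\frac{1}{2\sqrt2}Tol_l$; the map $\tilde u_l:\Omega\to H$ is measurable and $\tilde u_l\in L^2(\Omega;H)$. Monte Carlo notation: $\tilde u_0=0$; for $v\in L^2(\Omega;H)$ and $M\in\mathbb{N}$, $E_M[v]=\frac1M\sum_{i=1}^M v_i$ with independent, identically distributed copies $v_1,\dots,v_M$ of $v$. The estimators $E_{M_l}[\tilde u_l-\tilde u_{l-1}]$ on different levels $l$ are independent of each other. As usual, all copies are regarded as random variables on $\Omega$ (assumed rich enough), so that the $L^2(\Omega;H)$-norm of the error makes sense. *)

theory Defs
  imports "HOL-Probability.Probability"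
begin

(* Membership in and norm of the Bochner space L^2(Omega; 'b). Borel measurability is the right
   notion of (strong) measurability for separable 'b. This covers a separable Hilbert space 'h
   and also its dual 'h \<Rightarrow>\<^sub>L real, which is separable by the Riesz representation theorem although
   the type is no instance of second_countable_topology. *)
definition in_L2 :: "'w measure \<Rightarrow> ('w \<Rightarrow> 'b::real_normed_vector) \<Rightarrow> bool" where
  "in_L2 M v \<longleftrightarrow> v \<in> borel_measurable M \<and> integrable M (\<lambda>\<omega>. (norm (v \<omega>))\<^sup>2)"

(* Only meaningful together with in_L2: the Bochner integral of a non-integrable function is 0. *)
definition L2_norm :: "'w measure \<Rightarrow> ('w \<Rightarrow> 'b::real_normed_vector) \<Rightarrow> real" where
  "L2_norm M v = sqrt (\<integral>\<omega>. (norm (v \<omega>))\<^sup>2 \<partial>M)"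

definition in_Linf :: "'w measure \<Rightarrow> ('w \<Rightarrow> real) \<Rightarrow> bool" where
  "in_Linf M f \<longleftrightarrow> f \<in> borel_measurable M \<and> (\<exists>C. AE \<omega> in M. \<bar>f \<omega>\<bar> \<le> C)"

definition Var :: "'w measure \<Rightarrow> ('w \<Rightarrow> 'h::{real_inner, banach, second_countable_topology}) \<Rightarrow> real" where
  "Var M v = (\<integral>\<omega>. (norm ((\<integral>\<omega>'. v \<omega>' \<partial>M) - v \<omega>))\<^sup>2 \<partial>M)"

definition solves_VI ::
  "('h \<Rightarrow> 'h \<Rightarrow> real) \<Rightarrow> ('h::real_normed_vector \<Rightarrow>\<^sub>L real) \<Rightarrow> 'h set \<Rightarrow> 'h \<Rightarrow> bool" where
  "solves_VI a l K x \<longleftrightarrow> x \<in> K \<and> (\<forall>v\<in>K. a x (v - x) \<ge> blinfun_apply l (v - x))"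

(* Measurability of a closed-valued map: preimages (in the sense of hitting) of open sets are
   measurable. *)
definition measurable_set_valued :: "'w measure \<Rightarrow> ('w \<Rightarrow> 'h::topological_space set) \<Rightarrow> bool" where
  "measurable_set_valued M F \<longleftrightarrow> (\<forall>U. open U \<longrightarrow> {\<omega> \<in> space M. F \<omega> \<inter> U \<noteq> {}} \<in> sets M)"

definition iid_copies ::
  "'w measure \<Rightarrow> ('w \<Rightarrow> 'h::topological_space) \<Rightarrow> nat \<Rightarrow> (nat \<Rightarrow> 'w \<Rightarrow> 'h) \<Rightarrow> bool" where
  "iid_copies M v m X \<longleftrightarrow>
     prob_space.indep_vars M (\<lambda>_. borel) X {1..m} \<and>
     (\<forall>i\<in>{1..m}. distr M borel (X i) = distr M borel v)"

definition MC_estimator :: "nat \<Rightarrow> (nat \<Rightarrow> 'w \<Rightarrow> 'h::real_vector) \<Rightarrow> 'w \<Rightarrow> 'h" where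
  "MC_estimator m X \<omega> = (1 / real m) *\<^sub>R (\<Sum>i=1..m. X i \<omega>)"

(* X l i is the i-th copy on level l, and m l the number of copies on that level. *)
definition MLMC_estimator ::
  "nat \<Rightarrow> (nat \<Rightarrow> nat) \<Rightarrow> (nat \<Rightarrow> nat \<Rightarrow> 'w \<Rightarrow> 'h::real_vector) \<Rightarrow> 'w \<Rightarrow> 'h" where
  "MLMC_estimator L m X \<omega> = (\<Sum>l=1..L. MC_estimator (m l) (X l) \<omega>)"

end

theory Submission
  imports Defs
begin

text \<open>
  The mean-square error of the estimator splits into a squared bias and a variance
  (\<open>MLMC_estimator_error\<close>). By telescoping, the estimator has the mean of the finest approximation
  \<open>ut L\<close>, so the bias is at most the $L^2$ distance of \<open>u\<close> and \<open>ut L\<close>, which is at most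
  \<open>Tol L / sqrt 2\<close>: half of it comes from the discretisation and half from the inexact solver. This
  is the summand 1 in the bracket of the estimate.

  By independence (\<open>Var_sum_indep\<close>) the variance is the sum over the levels of the variances of
  \<open>ut l - ut (l - 1)\<close>, divided by \<open>m l\<close>. On level 1 the function \<open>ut 1\<close> is compared with \<open>u\<close>, whose
  variance remains in the estimate. On a higher level both \<open>ut l\<close> and \<open>ut (l - 1)\<close> are close to \<open>u\<close>,
  so their difference has $L^2$ norm at most \<open>(Tol l + Tol (l - 1)) / sqrt 2\<close>, and the geometric decay
  of the tolerances expresses this by \<open>Tol L\<close>.

  All of this presupposes that \<open>u\<close> and the Galerkin solutions \<open>u' l\<close> are square-integrable, which has
  to be derived from the variational inequalities. Square-integrability of \<open>u\<close> follows from the usual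
  a priori bound (\<open>solution_norm_bound\<close>), and that of \<open>u' l\<close> from its bounded distance to \<open>ut l\<close>. The
  essential point is measurability (\<open>random_VI_solution_measurable\<close>): a solution is the limit of
  approximate solutions that are chosen, in a measurable way, from a countable dense set.
\<close>

section \<open>Square-integrable random variables\<close>

text \<open>
  Young's inequality for the mixed term. With \<open>s\<close> the ratio of bounds on \<open>norm y\<close> and \<open>norm x\<close>, the
  right-hand side is at most the square of the sum of these bounds, so that after integration
  nothing is lost against the triangle inequality in $L^2$.
\<close>
lemma norm_add_power2_le:
  fixes x y :: "'a::real_normed_vector"
  assumes "s > 0"
  shows "(norm (x + y))\<^sup>2 \<le> (1 + s) * (norm x)\<^sup>2 + (1 + inverse s) * (norm y)\<^sup>2"
proof -
  have "(norm (x + y))\<^sup>2 \<le> (norm x + norm y)\<^sup>2"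
    by (intro power_mono norm_triangle_ineq) simp
  also have "\<dots> \<le> (norm x + norm y)\<^sup>2 + inverse s * (s * norm x - norm y)\<^sup>2"
    using assms by simp
  also have "\<dots> = (1 + s) * (norm x)\<^sup>2 + (1 + inverse s) * (norm y)\<^sup>2"
    using assms by (simp add: field_simps power2_eq_square)
  finally show ?thesis .
qed

lemma L2_norm_power2: "(L2_norm M v)\<^sup>2 = (\<integral>\<omega>. (norm (v \<omega>))\<^sup>2 \<partial>M)"
  unfolding L2_norm_def by simp

lemma in_L2_measurable: "in_L2 M v \<Longrightarrow> v \<in> borel_measurable M"
  by (simp add: in_L2_def)

lemma in_L2_integrable: "in_L2 M v \<Longrightarrow> integrable M (\<lambda>\<omega>. (norm (v \<omega>))\<^sup>2)"
  by (simp add: in_L2_def)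

lemma in_L2_dominated:
  assumes "in_L2 M w" "v \<in> borel_measurable M" "AE \<omega> in M. norm (v \<omega>) \<le> norm (w \<omega>)"
  shows "in_L2 M v"
  unfolding in_L2_def
proof
  show "v \<in> borel_measurable M" by fact
  show "integrable M (\<lambda>\<omega>. (norm (v \<omega>))\<^sup>2)"
  proof (rule Bochner_Integration.integrable_bound[OF in_L2_integrable[OF assms(1)]])
    show "(\<lambda>\<omega>. (norm (v \<omega>))\<^sup>2) \<in> borel_measurable M"
      using assms(2) by measurable
    show "AE \<omega> in M. norm ((norm (v \<omega>))\<^sup>2) \<le> norm ((norm (w \<omega>))\<^sup>2)"
      using assms(3) by eventually_elim (simp add: power_mono)
  qed
qed

lemma in_L2_norm: "in_L2 M v \<Longrightarrow> in_L2 M (\<lambda>\<omega>. norm (v \<omega>))"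
  by (auto simp: in_L2_def)

lemma in_L2_add:
  fixes v w :: "'w \<Rightarrow> 'b::{real_normed_vector, second_countable_topology}"
  assumes "in_L2 M v" "in_L2 M w"
  shows "in_L2 M (\<lambda>\<omega>. v \<omega> + w \<omega>)"
  unfolding in_L2_def
proof
  show meas: "(\<lambda>\<omega>. v \<omega> + w \<omega>) \<in> borel_measurable M"
    using assms by (auto simp: in_L2_def)
  show "integrable M (\<lambda>\<omega>. (norm (v \<omega> + w \<omega>))\<^sup>2)"
  proof (rule Bochner_Integration.integrable_bound)
    show "integrable M (\<lambda>\<omega>. 2 * (norm (v \<omega>))\<^sup>2 + 2 * (norm (w \<omega>))\<^sup>2)"
      using assms by (simp add: in_L2_def)
    show "(\<lambda>\<omega>. (norm (v \<omega> + w \<omega>))\<^sup>2) \<in> borel_measurable M"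
      using meas by measurable
    show "AE \<omega> in M. norm ((norm (v \<omega> + w \<omega>))\<^sup>2) \<le> norm (2 * (norm (v \<omega>))\<^sup>2 + 2 * (norm (w \<omega>))\<^sup>2)"
      using norm_add_power2_le[of 1] by (intro AE_I2) simp
  qed
qed

lemma L2_norm_add_power2_le:
  fixes v w :: "'w \<Rightarrow> 'b::{real_normed_vector, second_countable_topology}"
  assumes v: "in_L2 M v" and w: "in_L2 M w" and s: "s > 0"
  shows "(L2_norm M (\<lambda>\<omega>. v \<omega> + w \<omega>))\<^sup>2
    \<le> (1 + s) * (L2_norm M v)\<^sup>2 + (1 + inverse s) * (L2_norm M w)\<^sup>2"
proof -
  have "(\<integral>\<omega>. (norm (v \<omega> + w \<omega>))\<^sup>2 \<partial>M)
      \<le> (\<integral>\<omega>. (1 + s) * (norm (v \<omega>))\<^sup>2 + (1 + inverse s) * (norm (w \<omega>))\<^sup>2 \<partial>M)"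
    using in_L2_integrable[OF v] in_L2_integrable[OF w]
    by (intro integral_mono in_L2_integrable[OF in_L2_add[OF v w]] norm_add_power2_le[OF s]) simp
  also have "\<dots> = (1 + s) * (L2_norm M v)\<^sup>2 + (1 + inverse s) * (L2_norm M w)\<^sup>2"
    using in_L2_integrable[OF v] in_L2_integrable[OF w] by (simp add: L2_norm_power2)
  finally show ?thesis
    by (simp add: L2_norm_power2)
qed

lemma in_L2_scaleR:
  assumes "in_L2 M v"
  shows "in_L2 M (\<lambda>\<omega>. c *\<^sub>R v \<omega>)"
  using assms by (auto simp: in_L2_def power_mult_distrib)

lemma in_L2_diff:
  fixes v w :: "'w \<Rightarrow> 'b::{real_normed_vector, second_countable_topology}"
  assumes "in_L2 M v" "in_L2 M w"
  shows "in_L2 M (\<lambda>\<omega>. v \<omega> - w \<omega>)"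
  using in_L2_add[OF assms(1) in_L2_scaleR[OF assms(2), of "-1"]] by simp

lemma in_L2_sum:
  fixes v :: "'i \<Rightarrow> 'w \<Rightarrow> 'b::{real_normed_vector, second_countable_topology}"
  assumes "\<And>i. i \<in> I \<Longrightarrow> in_L2 M (v i)"
  shows "in_L2 M (\<lambda>\<omega>. \<Sum>i\<in>I. v i \<omega>)"
  using assms
proof (induction I rule: infinite_finite_induct)
  case (insert i I)
  then show ?case by (simp add: in_L2_add)
qed (simp_all add: in_L2_def)

lemma in_L2_inner_integrable:
  fixes v w :: "'w \<Rightarrow> 'h::{real_inner, second_countable_topology}"
  assumes "in_L2 M v" "in_L2 M w"
  shows "integrable M (\<lambda>\<omega>. v \<omega> \<bullet> w \<omega>)"
proof (rule Bochner_Integration.integrable_bound)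
  show "integrable M (\<lambda>\<omega>. (norm (v \<omega>))\<^sup>2 + (norm (w \<omega>))\<^sup>2)"
    using assms by (simp add: in_L2_def)
  show "(\<lambda>\<omega>. v \<omega> \<bullet> w \<omega>) \<in> borel_measurable M"
    using assms by (auto simp: in_L2_def)
  have "\<bar>x \<bullet> y\<bar> \<le> (norm x)\<^sup>2 + (norm y)\<^sup>2" for x y :: 'h
  proof -
    have "\<bar>x \<bullet> y\<bar> \<le> norm x * norm y" by (rule Cauchy_Schwarz_ineq2)
    also have "\<dots> \<le> (norm x)\<^sup>2 + (norm y)\<^sup>2"
      using sum_squares_bound[of "norm x" "norm y"] mult_nonneg_nonneg[OF norm_ge_zero norm_ge_zero, of x y]
      by linarith
    finally show ?thesis .
  qed
  then show "AE \<omega> in M. norm (v \<omega> \<bullet> w \<omega>) \<le> norm ((norm (v \<omega>))\<^sup>2 + (norm (w \<omega>))\<^sup>2)"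
    by (intro AE_I2) simp
qed

lemma (in finite_measure) in_L2_const: "in_L2 M (\<lambda>_. c)"
  by (simp add: in_L2_def)

lemma (in finite_measure) in_L2_imp_integrable:
  fixes v :: "'a \<Rightarrow> 'b::{banach, second_countable_topology}"
  assumes "in_L2 M v"
  shows "integrable M v"
proof -
  have "integrable M (\<lambda>\<omega>. norm (v \<omega>) \<bullet> (1::real))"
    by (intro in_L2_inner_integrable in_L2_norm in_L2_const assms)
  then show ?thesis
    using in_L2_measurable[OF assms] by (simp add: integrable_norm_iff)
qed

section \<open>Variance of Hilbert-space valued random variables\<close>

context prob_space
begin

text \<open>
  The bias--variance decomposition: the mixed term \<open>(c - E v) \<bullet> (E v - v)\<close> has mean zero.
\<close>
lemma expectation_norm_diff_power2:
  fixes v :: "'a \<Rightarrow> 'h::{real_inner, banach, second_countable_topology}"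
  assumes "in_L2 M v"
  shows "(\<integral>\<omega>. (norm (c - v \<omega>))\<^sup>2 \<partial>M) = (norm (c - (\<integral>\<omega>. v \<omega> \<partial>M)))\<^sup>2 + Var M v"
proof -
  let ?e = "\<integral>\<omega>. v \<omega> \<partial>M"
  have int: "integrable M v"
    by (rule in_L2_imp_integrable[OF assms])
  have int2: "integrable M (\<lambda>\<omega>. (norm (?e - v \<omega>))\<^sup>2)"
    by (intro in_L2_integrable in_L2_diff in_L2_const assms)
  have "(norm (c - v \<omega>))\<^sup>2 = (norm (c - ?e))\<^sup>2 + 2 * ((c - ?e) \<bullet> (?e - v \<omega>)) + (norm (?e - v \<omega>))\<^sup>2" for \<omega>
    using dot_norm[of "c - ?e" "?e - v \<omega>"] by simp
  then have "(\<integral>\<omega>. (norm (c - v \<omega>))\<^sup>2 \<partial>M) =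
      (\<integral>\<omega>. (norm (c - ?e))\<^sup>2 + 2 * ((c - ?e) \<bullet> (?e - v \<omega>)) + (norm (?e - v \<omega>))\<^sup>2 \<partial>M)"
    by simp
  also have "\<dots> = (norm (c - ?e))\<^sup>2 + Var M v"
    using int int2 by (simp add: Var_def prob_space)
  finally show ?thesis .
qed

lemma Var_le:
  fixes v :: "'a \<Rightarrow> 'h::{real_inner, banach, second_countable_topology}"
  assumes "in_L2 M v"
  shows "Var M v \<le> (\<integral>\<omega>. (norm (v \<omega>))\<^sup>2 \<partial>M)"
  using expectation_norm_diff_power2[OF assms, of 0] by simp

lemma norm_expectation_power2_le:
  fixes v :: "'a \<Rightarrow> 'h::{real_inner, banach, second_countable_topology}"
  assumes "in_L2 M v"
  shows "(norm (\<integral>\<omega>. v \<omega> \<partial>M))\<^sup>2 \<le> (\<integral>\<omega>. (norm (v \<omega>))\<^sup>2 \<partial>M)"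
proof -
  have "Var M v \<ge> 0" unfolding Var_def by simp
  then show ?thesis
    using expectation_norm_diff_power2[OF assms, of 0] by simp
qed

lemma Var_scaleR:
  fixes v :: "'a \<Rightarrow> 'h::{real_inner, banach, second_countable_topology}"
  shows "Var M (\<lambda>\<omega>. c *\<^sub>R v \<omega>) = c\<^sup>2 * Var M v"
proof -
  have "(norm (c *\<^sub>R x - c *\<^sub>R y))\<^sup>2 = c\<^sup>2 * (norm (x - y))\<^sup>2" for x y :: 'h
    by (simp add: power_mult_distrib flip: scaleR_diff_right)
  then show ?thesis unfolding Var_def by simp
qed

lemma Var_add_le:
  fixes v w :: "'a \<Rightarrow> 'h::{real_inner, banach, second_countable_topology}"
  assumes v: "in_L2 M v" and w: "in_L2 M w" and s: "s > 0"
  shows "Var M (\<lambda>\<omega>. v \<omega> + w \<omega>) \<le> (1 + s) * Var M v + (1 + inverse s) * Var M w"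
proof -
  have int: "integrable M v" "integrable M w"
    using v w by (auto intro: in_L2_imp_integrable)
  have "(\<integral>\<omega>. v \<omega> + w \<omega> \<partial>M) - (v \<omega> + w \<omega>) =
      ((\<integral>\<omega>. v \<omega> \<partial>M) - v \<omega>) + ((\<integral>\<omega>. w \<omega> \<partial>M) - w \<omega>)" for \<omega>
    using int by simp
  then show ?thesis
    using L2_norm_add_power2_le[OF in_L2_diff[OF in_L2_const v] in_L2_diff[OF in_L2_const w] s,
        of "\<integral>\<omega>. v \<omega> \<partial>M" "\<integral>\<omega>. w \<omega> \<partial>M"]
    by (simp only: Var_def L2_norm_power2)
qed

text \<open>
  Independence makes the joint law a product measure; by Fubini the bounded linear functional
  \<open>y \<mapsto> x \<bullet> y\<close> is then integrated first, and commutes with the Bochner integral.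
\<close>
lemma indep_var_integral_inner:
  fixes X Y :: "'a \<Rightarrow> 'h::{real_inner, banach, second_countable_topology}"
  assumes indep: "indep_var borel X borel Y" and L2: "in_L2 M X" "in_L2 M Y"
  shows "(\<integral>\<omega>. X \<omega> \<bullet> Y \<omega> \<partial>M) = (\<integral>\<omega>. X \<omega> \<partial>M) \<bullet> (\<integral>\<omega>. Y \<omega> \<partial>M)"
proof -
  have [measurable]: "X \<in> borel_measurable M" "Y \<in> borel_measurable M"
    using L2 by (auto simp: in_L2_def)
  let ?PX = "distr M borel X" and ?PY = "distr M borel Y"
  interpret PX: prob_space ?PX by (rule prob_space_distr) simp
  interpret PY: prob_space ?PY by (rule prob_space_distr) simp
  interpret P: pair_prob_space ?PX ?PY ..
  have joint: "?PX \<Otimes>\<^sub>M ?PY = distr M (borel \<Otimes>\<^sub>M borel) (\<lambda>\<omega>. (X \<omega>, Y \<omega>))"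
    using indep by (simp add: indep_var_distribution_eq)
  have intX: "integrable M X" and intY: "integrable M Y"
    using L2 by (auto intro: in_L2_imp_integrable)
  have int: "integrable (?PX \<Otimes>\<^sub>M ?PY) (\<lambda>(x, y). x \<bullet> y)"
    unfolding joint using in_L2_inner_integrable[OF L2]
    by (simp add: integrable_distr_eq)
  have "(\<integral>\<omega>. X \<omega> \<bullet> Y \<omega> \<partial>M) = (\<integral>p. (\<lambda>(x, y). x \<bullet> y) p \<partial>(?PX \<Otimes>\<^sub>M ?PY))"
    unfolding joint by (simp add: integral_distr)
  also have "\<dots> = (\<integral>x. (\<integral>y. x \<bullet> y \<partial>?PY) \<partial>?PX)"
    using P.integral_fst'[OF int] by simp
  also have "\<dots> = (\<integral>x. x \<bullet> (\<integral>\<omega>. Y \<omega> \<partial>M) \<partial>?PX)"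
    using intY by (simp add: integral_distr)
  also have "\<dots> = (\<integral>\<omega>. X \<omega> \<partial>M) \<bullet> (\<integral>\<omega>. Y \<omega> \<partial>M)"
    using intX by (simp add: integral_distr)
  finally show ?thesis .
qed

text \<open>
  Bienayme's identity in a Hilbert space: the centred summands are pairwise orthogonal in $L^2$.
\<close>
lemma Var_sum_indep:
  fixes X :: "'i \<Rightarrow> 'a \<Rightarrow> 'h::{real_inner, banach, second_countable_topology}"
  assumes indep: "indep_vars (\<lambda>_. borel) X I" and L2: "\<And>i. i \<in> I \<Longrightarrow> in_L2 M (X i)"
    and fin: "finite I"
  shows "Var M (\<lambda>\<omega>. \<Sum>i\<in>I. X i \<omega>) = (\<Sum>i\<in>I. Var M (X i))"
proof -
  define Z where "Z i \<omega> = (\<integral>\<omega>'. X i \<omega>' \<partial>M) - X i \<omega>" for i \<omega>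
  have int: "integrable M (X i)" if "i \<in> I" for i
    using L2[OF that] by (rule in_L2_imp_integrable)
  have Z_L2: "in_L2 M (Z i)" if "i \<in> I" for i
    unfolding Z_def by (intro in_L2_diff in_L2_const L2 that)
  have Z_mean: "(\<integral>\<omega>. Z i \<omega> \<partial>M) = 0" if "i \<in> I" for i
    unfolding Z_def using int[OF that] by (simp add: prob_space)
  have Z_orth: "(\<integral>\<omega>. Z i \<omega> \<bullet> Z j \<omega> \<partial>M) = 0" if ij: "i \<in> I" "j \<in> I" "i \<noteq> j" for i j
  proof -
    have "indep_var
        borel ((\<lambda>f. (\<integral>\<omega>'. X i \<omega>' \<partial>M) - f i) \<circ> (\<lambda>\<omega>. restrict (\<lambda>i. X i \<omega>) {i}))
        borel ((\<lambda>f. (\<integral>\<omega>'. X j \<omega>' \<partial>M) - f j) \<circ> (\<lambda>\<omega>. restrict (\<lambda>i. X i \<omega>) {j}))"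
      using ij by (intro indep_var_compose[OF indep_var_restrict[OF indep]]) auto
    then have "indep_var borel (Z i) borel (Z j)"
      by (simp add: Z_def[abs_def] comp_def)
    then show ?thesis
      using ij by (simp add: indep_var_integral_inner Z_L2 Z_mean)
  qed
  have "Var M (\<lambda>\<omega>. \<Sum>i\<in>I. X i \<omega>) = (\<integral>\<omega>. (norm (\<Sum>i\<in>I. Z i \<omega>))\<^sup>2 \<partial>M)"
    unfolding Var_def Z_def using int by (simp add: sum_subtractf)
  also have "\<dots> = (\<integral>\<omega>. (\<Sum>i\<in>I. \<Sum>j\<in>I. Z i \<omega> \<bullet> Z j \<omega>) \<partial>M)"
    unfolding power2_norm_eq_inner inner_sum_left by (simp add: inner_sum_right)
  also have "\<dots> = (\<Sum>i\<in>I. \<Sum>j\<in>I. \<integral>\<omega>. Z i \<omega> \<bullet> Z j \<omega> \<partial>M)"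
    by (subst Bochner_Integration.integral_sum,
        force intro: Bochner_Integration.integrable_sum in_L2_inner_integrable Z_L2)+
      (simp add: Bochner_Integration.integral_sum in_L2_inner_integrable Z_L2)
  also have "\<dots> = (\<Sum>i\<in>I. \<Sum>j\<in>I. if j = i then \<integral>\<omega>. Z i \<omega> \<bullet> Z i \<omega> \<partial>M else 0)"
    by (intro sum.cong refl) (auto simp: Z_orth)
  also have "\<dots> = (\<Sum>i\<in>I. Var M (X i))"
    using fin by (simp add: Var_def Z_def power2_norm_eq_inner)
  finally show ?thesis .
qed

section \<open>Monte Carlo estimators\<close>

lemma same_distr_moments:
  fixes v w :: "'a \<Rightarrow> 'h::{real_inner, banach, second_countable_topology}"
  assumes distr: "distr M borel w = distr M borel v" and w: "w \<in> borel_measurable M" and v: "in_L2 M v"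
  shows "in_L2 M w" "(\<integral>\<omega>. w \<omega> \<partial>M) = (\<integral>\<omega>. v \<omega> \<partial>M)" "Var M w = Var M v"
proof -
  have vm: "v \<in> borel_measurable M"
    using v by (rule in_L2_measurable)
  have transfer: "(\<integral>\<omega>. g (w \<omega>) \<partial>M) = (\<integral>\<omega>. g (v \<omega>) \<partial>M)"
    if "g \<in> borel_measurable borel" for g :: "'h \<Rightarrow> 'c::{banach, second_countable_topology}"
    using integral_distr[OF w that] integral_distr[OF vm that] distr by simp
  have "integrable (distr M borel w) (\<lambda>x. (norm x)\<^sup>2)"
    unfolding distr using v vm by (subst integrable_distr_eq) (auto simp: in_L2_def)
  then show "in_L2 M w"
    using w by (simp add: in_L2_def integrable_distr_eq)
  show mean: "(\<integral>\<omega>. w \<omega> \<partial>M) = (\<integral>\<omega>. v \<omega> \<partial>M)"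
    using transfer[of "\<lambda>x. x"] by simp
  show "Var M w = Var M v"
    unfolding Var_def mean by (rule transfer) simp
qed

lemma MC_estimator_moments:
  fixes v :: "'a \<Rightarrow> 'h::{real_inner, banach, second_countable_topology}"
  assumes v: "in_L2 M v" and iid: "iid_copies M v m X" and m: "m \<ge> 1"
  shows "in_L2 M (MC_estimator m X)"
    "(\<integral>\<omega>. MC_estimator m X \<omega> \<partial>M) = (\<integral>\<omega>. v \<omega> \<partial>M)"
    "Var M (MC_estimator m X) = inverse (real m) * Var M v"
proof -
  have indep: "indep_vars (\<lambda>_. borel) X {1..m}"
    using iid by (simp add: iid_copies_def)
  have meas: "X i \<in> borel_measurable M" if "i \<in> {1..m}" for i
    using indep that by (simp add: indep_vars_def)
  have distr: "distr M borel (X i) = distr M borel v" if "i \<in> {1..m}" for i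
    using iid that by (simp add: iid_copies_def)
  note X = same_distr_moments[OF distr meas v]
  have est: "MC_estimator m X = (\<lambda>\<omega>. (1 / real m) *\<^sub>R (\<Sum>i=1..m. X i \<omega>))"
    by (simp add: MC_estimator_def fun_eq_iff)
  show "in_L2 M (MC_estimator m X)"
    unfolding est by (intro in_L2_scaleR in_L2_sum X)
  have "(\<integral>\<omega>. MC_estimator m X \<omega> \<partial>M) = (1 / real m) *\<^sub>R (\<Sum>i=1..m. \<integral>\<omega>. X i \<omega> \<partial>M)"
    unfolding est by (simp add: Bochner_Integration.integral_sum in_L2_imp_integrable X)
  also have "\<dots> = (\<integral>\<omega>. v \<omega> \<partial>M)"
    using m by (simp add: X(2) sum_constant_scaleR)
  finally show "(\<integral>\<omega>. MC_estimator m X \<omega> \<partial>M) = (\<integral>\<omega>. v \<omega> \<partial>M)" .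
  have "Var M (MC_estimator m X) = (1 / real m)\<^sup>2 * (\<Sum>i=1..m. Var M (X i))"
    unfolding est Var_scaleR by (subst Var_sum_indep[OF indep]) (simp_all add: X)
  also have "(\<Sum>i=1..m. Var M (X i)) = real m * Var M v"
    by (simp add: X(3))
  also have "(1 / real m)\<^sup>2 * (real m * Var M v) = inverse (real m) * Var M v"
    using m by (simp add: power2_eq_square field_simps)
  finally show "Var M (MC_estimator m X) = inverse (real m) * Var M v" .
qed

text \<open>
  The mean of the estimator telescopes to the mean of the finest level, so the bias involves only
  \<open>v L\<close>; independence of the levels lets their variances add up.
\<close>
lemma MLMC_estimator_error:
  fixes v :: "nat \<Rightarrow> 'a \<Rightarrow> 'h::{real_inner, banach, second_countable_topology}"
  assumes v0: "v 0 = (\<lambda>_. 0)" and v: "\<And>l. l \<in> {1..L} \<Longrightarrow> in_L2 M (v l)"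
    and m: "\<And>l. l \<in> {1..L} \<Longrightarrow> m l \<ge> 1"
    and iid: "\<And>l. l \<in> {1..L} \<Longrightarrow> iid_copies M (\<lambda>\<omega>. v l \<omega> - v (l - 1) \<omega>) (m l) (X l)"
    and indep: "indep_vars (\<lambda>_. borel) (\<lambda>l. MC_estimator (m l) (X l)) {1..L}"
  shows "in_L2 M (\<lambda>\<omega>. c - MLMC_estimator L m X \<omega>)"
    "(\<integral>\<omega>. (norm (c - MLMC_estimator L m X \<omega>))\<^sup>2 \<partial>M) =
      (norm (c - (\<integral>\<omega>. v L \<omega> \<partial>M)))\<^sup>2 +
      (\<Sum>l=1..L. inverse (real (m l)) * Var M (\<lambda>\<omega>. v l \<omega> - v (l - 1) \<omega>))"
proof -
  have v': "in_L2 M (v l)" if "l \<le> L" for l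
    using v[of l] that v0 in_L2_const[of 0] by (cases "l = 0") auto
  have diff: "in_L2 M (\<lambda>\<omega>. v l \<omega> - v (l - 1) \<omega>)" if "l \<in> {1..L}" for l
    using that by (intro in_L2_diff v') auto
  note MC = MC_estimator_moments[OF diff iid m]
  have est: "MLMC_estimator L m X = (\<lambda>\<omega>. \<Sum>l=1..L. MC_estimator (m l) (X l) \<omega>)"
    by (simp add: MLMC_estimator_def fun_eq_iff)
  have est_L2: "in_L2 M (MLMC_estimator L m X)"
    unfolding est by (intro in_L2_sum MC)
  then show "in_L2 M (\<lambda>\<omega>. c - MLMC_estimator L m X \<omega>)"
    by (intro in_L2_diff in_L2_const)
  have "(\<integral>\<omega>. MLMC_estimator L m X \<omega> \<partial>M) = (\<Sum>l=1..L. \<integral>\<omega>. v l \<omega> - v (l - 1) \<omega> \<partial>M)"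
    unfolding est by (simp add: Bochner_Integration.integral_sum in_L2_imp_integrable MC)
  also have "\<dots> = (\<Sum>l=1..L. (\<integral>\<omega>. v l \<omega> \<partial>M) - (\<integral>\<omega>. v (l - 1) \<omega> \<partial>M))"
    by (intro sum.cong refl Bochner_Integration.integral_diff in_L2_imp_integrable v') auto
  also have "\<dots> = (\<integral>\<omega>. v L \<omega> \<partial>M)"
    using sum_telescope''[of 0 L "\<lambda>l. \<integral>\<omega>. v l \<omega> \<partial>M"] by (simp add: v0)
  finally have mean: "(\<integral>\<omega>. MLMC_estimator L m X \<omega> \<partial>M) = (\<integral>\<omega>. v L \<omega> \<partial>M)" .
  have "Var M (MLMC_estimator L m X) =
      (\<Sum>l=1..L. inverse (real (m l)) * Var M (\<lambda>\<omega>. v l \<omega> - v (l - 1) \<omega>))"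
    unfolding est by (subst Var_sum_indep[OF indep]) (simp_all add: MC)
  then show "(\<integral>\<omega>. (norm (c - MLMC_estimator L m X \<omega>))\<^sup>2 \<partial>M) =
      (norm (c - (\<integral>\<omega>. v L \<omega> \<partial>M)))\<^sup>2 +
      (\<Sum>l=1..L. inverse (real (m l)) * Var M (\<lambda>\<omega>. v l \<omega> - v (l - 1) \<omega>))"
    using expectation_norm_diff_power2[OF est_L2] mean by simp
qed

end

section \<open>Measurability of solutions of random variational inequalities\<close>

text \<open>
  By continuity, \<open>f \<omega>\<close> is negative at some point of \<open>F \<omega>\<close> iff \<open>F \<omega>\<close> hits a basic open set on
  which \<open>f \<omega>\<close> stays below a negative constant. Such a bound can be tested on a countable dense
  set, which leaves only countably many measurable conditions. In other words, the infimum of a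
  Caratheodory function over a measurable set-valued map is measurable.
\<close>
lemma measurable_set_valued_ex_less:
  fixes F :: "'w \<Rightarrow> 'h::second_countable_topology set" and f :: "'w \<Rightarrow> 'h \<Rightarrow> real"
  assumes F: "measurable_set_valued M F"
    and f: "\<And>x. (\<lambda>\<omega>. f \<omega> x) \<in> borel_measurable M"
    and cont: "\<And>\<omega>. \<omega> \<in> space M \<Longrightarrow> continuous_on UNIV (f \<omega>)"
  shows "{\<omega> \<in> space M. \<exists>x\<in>F \<omega>. f \<omega> x < 0} \<in> sets M"
proof -
  obtain D :: "'h set" where D: "countable D" "\<And>U. open U \<Longrightarrow> U \<noteq> {} \<Longrightarrow> \<exists>d\<in>D. d \<in> U"
    using countable_dense_exists by auto
  obtain B :: "'h set set" where B: "countable B" "topological_basis B"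
    using ex_countable_basis by blast
  let ?below = "\<lambda>U n \<omega>. \<forall>d\<in>D \<inter> U. f \<omega> d \<le> - inverse (real (Suc n))"
  have "{\<omega> \<in> space M. \<exists>x\<in>F \<omega>. f \<omega> x < 0} =
      (\<Union>U\<in>B. \<Union>n. {\<omega> \<in> space M. F \<omega> \<inter> U \<noteq> {}} \<inter> {\<omega> \<in> space M. ?below U n \<omega>})" (is "?L = ?R")
  proof (intro set_eqI iffI)
    fix \<omega> assume "\<omega> \<in> ?L"
    then obtain x where \<omega>: "\<omega> \<in> space M" and x: "x \<in> F \<omega>" "f \<omega> x < 0" by auto
    obtain n where "inverse (real (Suc n)) < - f \<omega> x"
      using reals_Archimedean[of "- f \<omega> x"] x by auto
    then have n: "f \<omega> x < - inverse (real (Suc n))" by simp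
    have "open {y. f \<omega> y < - inverse (real (Suc n))}"
      using cont[OF \<omega>] by (intro open_Collect_less) auto
    then obtain U where "U \<in> B" "x \<in> U" "U \<subseteq> {y. f \<omega> y < - inverse (real (Suc n))}"
      using topological_basisE[OF B(2)] n by (metis mem_Collect_eq)
    then have "F \<omega> \<inter> U \<noteq> {}" "?below U n \<omega>"
      using x by (auto intro: less_imp_le)
    with \<omega> \<open>U \<in> B\<close> show "\<omega> \<in> ?R"
      by (intro UN_I[of U] UN_I[of n] IntI CollectI conjI) simp_all
  next
    fix \<omega> assume "\<omega> \<in> ?R"
    then obtain U n where U: "U \<in> B" and \<omega>: "\<omega> \<in> space M" and hit: "F \<omega> \<inter> U \<noteq> {}"
      and below: "?below U n \<omega>" by (elim UN_E IntE CollectE conjE)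
    from hit obtain x where x: "x \<in> F \<omega>" "x \<in> U" by blast
    have "f \<omega> x \<le> - inverse (real (Suc n))"
    proof (rule ccontr)
      assume above: "\<not> ?thesis"
      have "open (U \<inter> {y. - inverse (real (Suc n)) < f \<omega> y})"
        using cont[OF \<omega>] topological_basis_open[OF B(2) U]
        by (intro open_Int open_Collect_less) auto
      then obtain d where "d \<in> D" "d \<in> U" "- inverse (real (Suc n)) < f \<omega> d"
        using D(2)[of "U \<inter> {y. - inverse (real (Suc n)) < f \<omega> y}"] x above
        unfolding not_le by blast
      moreover from this below have "f \<omega> d \<le> - inverse (real (Suc n))"
        by blast
      ultimately show False by linarith
    qed
    also have "\<dots> < 0" by simp
    finally show "\<omega> \<in> ?L" using \<omega> x by blast
  qed
  also have "\<dots> \<in> sets M"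
  proof -
    have "{\<omega> \<in> space M. F \<omega> \<inter> U \<noteq> {}} \<in> sets M" if "U \<in> B" for U
      using F topological_basis_open[OF B(2) that] by (simp add: measurable_set_valued_def)
    moreover have "{\<omega> \<in> space M. ?below U n \<omega>} \<in> sets M" for U n
    proof (rule sets.sets_Collect_countable_All')
      show "countable (D \<inter> U)" using D(1) by simp
      show "{\<omega> \<in> space M. f \<omega> d \<le> - inverse (real (Suc n))} \<in> sets M" for d
        using f by measurable
    qed
    ultimately show ?thesis
      by (intro sets.countable_UN'[OF B(1)] sets.countable_UN image_subsetI sets.Int)
  qed
  finally show ?thesis .
qed

locale coercive_form =
  fixes a :: "'h::real_inner \<Rightarrow> 'h \<Rightarrow> real" and g C :: real
  assumes bilin: "bilinear a"
    and coercive: "g * (norm v)\<^sup>2 \<le> a v v" and g_pos: "g > 0"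
    and bounded: "a v w \<le> C * norm v * norm w" and C_nonneg: "C \<ge> 0"
begin

lemma abs_le: "\<bar>a v w\<bar> \<le> C * norm v * norm w"
  using bounded[of v w] bounded[of v "- w"] bilinear_rneg[OF bilin, of v w] by simp

text \<open>
  Test the inequality with \<open>w\<close> and use coercivity for \<open>x - w\<close>.
\<close>
lemma solution_norm_bound:
  assumes sol: "solves_VI a l K x" and w: "w \<in> K"
  shows "norm (x - w) \<le> (norm l + C * norm w) / g"
proof (cases "x = w")
  case True
  then show ?thesis using g_pos C_nonneg by simp
next
  case False
  have "a x (w - x) \<ge> l (w - x)"
    using sol w by (simp add: solves_VI_def)
  moreover have "a x (w - x) = - a (x - w) (x - w) + a w (w - x)"
    using bilin by (simp add: bilinear_lsub bilinear_rsub)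
  ultimately have "g * (norm (x - w))\<^sup>2 \<le> a w (w - x) - l (w - x)"
    using coercive[of "x - w"] by linarith
  also have "\<dots> \<le> C * norm w * norm (w - x) + norm l * norm (w - x)"
    using bounded[of w "w - x"] norm_blinfun[of l "w - x"] by simp
  also have "\<dots> = (norm l + C * norm w) * norm (x - w)"
    by (simp add: algebra_simps norm_minus_commute)
  finally have "g * norm (x - w) \<le> norm l + C * norm w"
    using False by (simp add: power2_eq_square)
  then show ?thesis using g_pos by (simp add: field_simps)
qed

end

text \<open>
  The candidates \<open>d\<close> will be taken from a countable dense set, which need not meet \<open>K\<close>; hence \<open>d\<close>
  only has to lie within \<open>e\<close> of \<open>K\<close>. The tolerance grows with \<open>norm (v - d)\<close> because replacing an
  exact solution by a nearby point perturbs the form by an amount that grows linearly with the test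
  point \<open>v\<close>, and \<open>K\<close> may be unbounded.
\<close>
definition approx_solution ::
  "('h \<Rightarrow> 'h \<Rightarrow> real) \<Rightarrow> ('h::real_normed_vector \<Rightarrow>\<^sub>L real) \<Rightarrow> 'h set \<Rightarrow> real \<Rightarrow> 'h \<Rightarrow> bool" where
  "approx_solution a l K e d \<longleftrightarrow>
     K \<inter> ball d e \<noteq> {} \<and> (\<forall>v\<in>K. 0 \<le> a d (v - d) - l (v - d) + e * (1 + norm (v - d)))"

context coercive_form
begin

text \<open>
  By continuity of the form, every point close enough to the solution is an approximate solution;
  in particular a dense set contains some.
\<close>
lemma approx_solution_near:
  assumes sol: "solves_VI a l K x" and e: "e > 0"
  shows "\<exists>r>0. \<forall>d\<in>ball x r. approx_solution a l K e d"
proof -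
  define r where "r = e / (1 + C + C * norm x + norm l)"
  have den: "1 + C + C * norm x + norm l > 0"
    using C_nonneg by (simp add: add_pos_nonneg)
  have r: "r > 0" "r * (1 + C + C * norm x + norm l) = e"
    using den e by (auto simp: r_def)
  have re: "r \<le> e" "C * r \<le> e" "(C * norm x + norm l) * r \<le> e"
  proof -
    have nonneg: "0 \<le> r * C" "0 \<le> r * (C * norm x)" "0 \<le> r * norm l"
      using r C_nonneg by simp_all
    have "r + r * C + r * (C * norm x) + r * norm l = e"
      using r(2) by (simp add: algebra_simps)
    moreover have "(C * norm x + norm l) * r = r * (C * norm x) + r * norm l" "C * r = r * C"
      by (simp_all add: algebra_simps)
    ultimately show "r \<le> e" "C * r \<le> e" "(C * norm x + norm l) * r \<le> e"
      using r(1) nonneg by linarith+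
  qed
  have "approx_solution a l K e d" if "d \<in> ball x r" for d
    unfolding approx_solution_def
  proof (intro conjI ballI)
    have d: "norm (d - x) \<le> r"
      using that by (simp add: dist_norm norm_minus_commute)
    show "K \<inter> ball d e \<noteq> {}"
      using sol that re by (auto simp: solves_VI_def dist_commute)
    fix v assume "v \<in> K"
    then have vi: "0 \<le> a x (v - x) - l (v - x)"
      using sol by (simp add: solves_VI_def)
    have 1: "- (e * norm (v - d)) \<le> a (d - x) (v - d)"
    proof -
      have "\<bar>a (d - x) (v - d)\<bar> \<le> C * norm (d - x) * norm (v - d)" by (rule abs_le)
      also have "\<dots> \<le> e * norm (v - d)"
        using d re C_nonneg by (intro mult_right_mono) (auto intro: order_trans[OF mult_left_mono])
      finally show ?thesis by linarith
    qed
    have 2: "- e \<le> a x (x - d) - l (x - d)"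
    proof -
      have "\<bar>a x (x - d)\<bar> + \<bar>l (x - d)\<bar> \<le> C * norm x * norm (x - d) + norm l * norm (x - d)"
        using abs_le[of x "x - d"] norm_blinfun[of l "x - d"] by simp
      also have "\<dots> = (C * norm x + norm l) * norm (d - x)"
        by (simp add: algebra_simps norm_minus_commute)
      also have "\<dots> \<le> (C * norm x + norm l) * r"
        using d C_nonneg by (intro mult_left_mono) auto
      finally show ?thesis using re by linarith
    qed
    have "a d (v - d) - l (v - d) =
        (a x (v - x) - l (v - x)) + a (d - x) (v - d) + (a x (x - d) - l (x - d))"
      using bilin by (simp add: bilinear_lsub bilinear_rsub blinfun.diff_right)
    then show "0 \<le> a d (v - d) - l (v - d) + e * (1 + norm (v - d))"
      using vi 1 2 by (simp add: algebra_simps)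
  qed
  then show ?thesis using r by blast
qed

text \<open>
  Test the approximate inequality with the exact solution \<open>x\<close> and the exact inequality with a
  point \<open>p\<close> of \<open>K\<close> near \<open>d\<close>. Adding both leaves \<open>a (d - x) (d - x)\<close>, up to terms of order \<open>e\<close>,
  and coercivity turns this into a bound on \<open>d - x\<close>.
\<close>
lemma approx_solution_error:
  assumes sol: "solves_VI a l K x" and approx: "approx_solution a l K e d" and e: "e \<ge> 0"
  shows "(norm (d - x))\<^sup>2 \<le> 2 * e * (1 + C * norm x + norm l) / g + (e / g)\<^sup>2"
proof -
  define t where "t = norm (d - x)"
  obtain p where p: "p \<in> K" "norm (p - d) < e"
    using approx by (auto simp: approx_solution_def dist_norm norm_minus_commute)
  have "0 \<le> a x (p - x) - l (p - x)"
    using sol p by (simp add: solves_VI_def)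
  moreover have "a x (p - d) - l (p - d) \<le> (C * norm x + norm l) * e"
  proof -
    have "a x (p - d) - l (p - d) \<le> C * norm x * norm (p - d) + norm l * norm (p - d)"
      using bounded[of x "p - d"] norm_blinfun[of l "p - d"] by simp
    also have "\<dots> = (C * norm x + norm l) * norm (p - d)"
      by (simp add: algebra_simps)
    also have "\<dots> \<le> (C * norm x + norm l) * e"
      using p C_nonneg by (intro mult_left_mono) auto
    finally show ?thesis .
  qed
  moreover have "0 \<le> a d (x - d) - l (x - d) + e * (1 + norm (x - d))"
    using approx sol by (simp add: approx_solution_def solves_VI_def)
  moreover have "a (d - x) (d - x) =
      (a x (p - d) - l (p - d)) - (a x (p - x) - l (p - x)) - (a d (x - d) - l (x - d))"
    using bilin by (simp add: bilinear_lsub bilinear_rsub blinfun.diff_right)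
  ultimately have "g * t\<^sup>2 \<le> e * (1 + C * norm x + norm l) + e * t"
    using coercive[of "d - x"] by (simp add: t_def algebra_simps norm_minus_commute)
  then have "t\<^sup>2 \<le> e * (1 + C * norm x + norm l) / g + (e / g) * t"
    using g_pos by (simp add: field_simps)
  moreover have "2 * ((e / g) * t) \<le> (e / g)\<^sup>2 + t\<^sup>2"
    using sum_squares_bound[of "e / g" t] by simp
  ultimately show ?thesis
    unfolding t_def by simp
qed

lemma approx_solutions_tendsto:
  assumes sol: "solves_VI a l K x"
    and approx: "\<And>k. approx_solution a l K (inverse (real (Suc k))) (d k)"
  shows "d \<longlonglongrightarrow> x"
proof -
  let ?e = "\<lambda>k. inverse (real (Suc k))"
  have "(\<lambda>k. 2 * ?e k * (1 + C * norm x + norm l) / g + (?e k / g)\<^sup>2)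
      \<longlonglongrightarrow> 2 * 0 * (1 + C * norm x + norm l) / g + (0 / g)\<^sup>2"
    using g_pos by (intro tendsto_intros LIMSEQ_inverse_real_of_nat) auto
  then have "(\<lambda>k. (norm (d k - x))\<^sup>2) \<longlonglongrightarrow> 0"
    by (intro Lim_null_comparison[where f="\<lambda>k. (norm (d k - x))\<^sup>2"] always_eventually allI)
      (use approx_solution_error[OF sol approx] in simp_all)
  then have "(\<lambda>k. norm (d k - x)) \<longlonglongrightarrow> 0"
    by (simp add: power_tendsto_0_iff)
  then show ?thesis
    by (simp add: LIM_zero_iff tendsto_norm_zero_iff)
qed

end

lemma (in complete_measure) borel_measurable_AE_eq:
  fixes f h :: "'a \<Rightarrow> 'b::topological_space"
  assumes f: "f \<in> borel_measurable M" and eq: "AE \<omega> in M. f \<omega> = h \<omega>"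
  shows "h \<in> borel_measurable M"
proof (rule measurableI)
  fix A :: "'b set" assume A: "A \<in> sets borel"
  show "h -` A \<inter> space M \<in> sets M"
  proof (rule in_sets_AE)
    show "AE \<omega> in M. \<omega> \<in> f -` A \<inter> space M \<longleftrightarrow> \<omega> \<in> h -` A \<inter> space M"
      using eq by eventually_elim simp
    show "f -` A \<inter> space M \<in> sets M"
      using f A by measurable
  qed auto
qed simp

text \<open>
  For each tolerance, whether a fixed point is an approximate solution is a measurable event, by
  \<open>measurable_set_valued_ex_less\<close>. Selecting the first approximate solution in an enumeration of a
  countable dense set therefore gives measurable functions, and these converge to the solution as
  the tolerance tends to zero. Completeness of the measure absorbs the exceptional null set.
\<close>
theorem random_VI_solution_measurable:
  fixes a :: "'w \<Rightarrow> 'h::{real_inner, banach, second_countable_topology} \<Rightarrow> 'h \<Rightarrow> real"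
  assumes M: "complete_measure M"
    and bilin: "\<And>\<omega>. \<omega> \<in> space M \<Longrightarrow> bilinear (a \<omega>)"
    and bounded: "\<And>\<omega> v w. \<omega> \<in> space M \<Longrightarrow> a \<omega> v w \<le> C \<omega> * norm v * norm w"
    and coercive: "AE \<omega> in M. g \<omega> > 0 \<and> (\<forall>v. g \<omega> * (norm v)\<^sup>2 \<le> a \<omega> v v)"
    and meas_a: "\<And>v w. (\<lambda>\<omega>. a \<omega> v w) \<in> borel_measurable M"
    and meas_l: "\<And>v. (\<lambda>\<omega>. blinfun_apply (l \<omega>) v) \<in> borel_measurable M"
    and K: "measurable_set_valued M K"
    and sol: "AE \<omega> in M. solves_VI (a \<omega>) (l \<omega>) (K \<omega>) (u \<omega>)"
  shows "u \<in> borel_measurable M"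
proof -
  interpret complete_measure M by fact
  obtain D :: "'h set" where D: "countable D" "\<And>U. open U \<Longrightarrow> U \<noteq> {} \<Longrightarrow> \<exists>d\<in>D. d \<in> U"
    using countable_dense_exists by auto
  have "D \<noteq> {}" using D(2)[of UNIV] by auto
  define dn where "dn = from_nat_into D"
  let ?e = "\<lambda>k. inverse (real (Suc k))"
  let ?approx = "\<lambda>k n \<omega>. approx_solution (a \<omega>) (l \<omega>) (K \<omega>) (?e k) (dn n)"
  have bb: "bounded_linear (a \<omega> v)" if "\<omega> \<in> space M" for \<omega> v
  proof (rule bounded_linear_intro[where K="\<bar>C \<omega> * norm v\<bar>"])
    show "a \<omega> v (x + y) = a \<omega> v x + a \<omega> v y" for x y
      using bilin[OF that] by (rule bilinear_radd)
    show "a \<omega> v (r *\<^sub>R x) = r *\<^sub>R a \<omega> v x" for r x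
      using bilinear_rmul[OF bilin[OF that]] by simp
    show "norm (a \<omega> v x) \<le> norm x * \<bar>C \<omega> * norm v\<bar>" for x
    proof -
      have "\<bar>a \<omega> v x\<bar> \<le> C \<omega> * norm v * norm x"
        using bounded[OF that, of v x] bounded[OF that, of v "- x"] bilinear_rneg[OF bilin[OF that], of v x]
        by simp
      also have "\<dots> \<le> norm x * \<bar>C \<omega> * norm v\<bar>"
        by (subst mult.commute) (intro mult_left_mono, auto)
      finally show ?thesis by simp
    qed
  qed
  have approx_meas: "{\<omega> \<in> space M. ?approx k n \<omega>} \<in> sets M" for k n
  proof -
    let ?f = "\<lambda>\<omega> v. a \<omega> (dn n) (v - dn n) - l \<omega> (v - dn n) + ?e k * (1 + norm (v - dn n))"
    have "{\<omega> \<in> space M. \<exists>v\<in>K \<omega>. ?f \<omega> v < 0} \<in> sets M"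
    proof (rule measurable_set_valued_ex_less[OF K])
      show "(\<lambda>\<omega>. ?f \<omega> v) \<in> borel_measurable M" for v
        using meas_a meas_l by (intro borel_measurable_add borel_measurable_diff) auto
      show "continuous_on UNIV (?f \<omega>)" if "\<omega> \<in> space M" for \<omega>
        by (intro continuous_intros bounded_linear.continuous_on[OF bb[OF that]])
    qed
    moreover have "{\<omega> \<in> space M. K \<omega> \<inter> ball (dn n) (?e k) \<noteq> {}} \<in> sets M"
      using K by (simp add: measurable_set_valued_def)
    moreover have "{\<omega> \<in> space M. ?approx k n \<omega>} =
        {\<omega> \<in> space M. K \<omega> \<inter> ball (dn n) (?e k) \<noteq> {}} - {\<omega> \<in> space M. \<exists>v\<in>K \<omega>. ?f \<omega> v < 0}"
      unfolding approx_solution_def not_less[symmetric] by blast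
    ultimately show ?thesis by (simp only: sets.Diff)
  qed
  define w where "w k \<omega> = dn (LEAST n. ?approx k n \<omega>)" for k \<omega>
  have w_meas: "w k \<in> borel_measurable M" for k
  proof -
    have "(\<lambda>\<omega>. ?approx k n \<omega>) \<in> measurable M (count_space UNIV)" for n
      using approx_meas by (simp add: pred_def)
    then have "(\<lambda>\<omega>. LEAST n. ?approx k n \<omega>) \<in> measurable M (count_space UNIV)"
      by (rule measurable_Least)
    then show ?thesis
      unfolding w_def by (rule measurable_compose) simp
  qed
  have conv: "AE \<omega> in M. (\<lambda>k. w k \<omega>) \<longlonglongrightarrow> u \<omega>"
    using coercive sol AE_space
  proof eventually_elim
    case (elim \<omega>)
    interpret coercive_form "a \<omega>" "g \<omega>" "\<bar>C \<omega>\<bar>"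
    proof
      show "a \<omega> v w \<le> \<bar>C \<omega>\<bar> * norm v * norm w" for v w
        using bounded[of \<omega> v w] elim mult_right_mono[OF abs_ge_self[of "C \<omega>"], of "norm v * norm w"]
        by (simp add: mult.assoc)
    qed (use elim bilin in auto)
    have "?approx k (LEAST n. ?approx k n \<omega>) \<omega>" for k
    proof -
      obtain r where r: "r > 0" "\<And>d. d \<in> ball (u \<omega>) r \<Longrightarrow> approx_solution (a \<omega>) (l \<omega>) (K \<omega>) (?e k) d"
        using approx_solution_near[OF elim(2), of "?e k"] by auto
      obtain d where "d \<in> D" "d \<in> ball (u \<omega>) r"
        using D(2)[of "ball (u \<omega>) r"] r(1) by auto
      then obtain n where "?approx k n \<omega>"
        using from_nat_into_surj[OF D(1)] r(2) unfolding dn_def by metis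
      then show ?thesis by (rule LeastI)
    qed
    then show ?case
      unfolding w_def by (intro approx_solutions_tendsto[OF elim(2)])
  qed
  have "(\<lambda>\<omega>. lim (\<lambda>k. w k \<omega>)) \<in> borel_measurable M"
    using w_meas by (rule borel_measurable_lim_metric)
  moreover have "AE \<omega> in M. lim (\<lambda>k. w k \<omega>) = u \<omega>"
    using conv by eventually_elim (rule limI)
  ultimately show ?thesis
    by (rule borel_measurable_AE_eq)
qed

lemma VI_solution_in_L2:
  fixes a :: "'w \<Rightarrow> 'h::{real_inner, banach, second_countable_topology} \<Rightarrow> 'h \<Rightarrow> real"
  assumes M: "finite_measure M"
    and form: "AE \<omega> in M. coercive_form (a \<omega>) g C"
    and w: "w \<in> K" and l: "in_L2 M l"
    and sol: "AE \<omega> in M. solves_VI (a \<omega>) (l \<omega>) K (u \<omega>)"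
    and meas: "u \<in> borel_measurable M"
  shows "in_L2 M u"
proof -
  interpret finite_measure M by fact
  have bound: "in_L2 M (\<lambda>\<omega>. norm w + inverse g *\<^sub>R (norm (l \<omega>) + C * norm w))"
    by (intro in_L2_add in_L2_scaleR in_L2_norm in_L2_const l)
  show ?thesis
  proof (rule in_L2_dominated[OF bound meas])
    show "AE \<omega> in M. norm (u \<omega>) \<le> norm (norm w + inverse g *\<^sub>R (norm (l \<omega>) + C * norm w))"
      using form sol
    proof eventually_elim
      case (elim \<omega>)
      interpret coercive_form "a \<omega>" g C by (rule elim)
      have "norm (u \<omega>) \<le> norm w + norm (u \<omega> - w)"
        by (rule norm_triangle_sub)
      also have "\<dots> \<le> norm w + inverse g *\<^sub>R (norm (l \<omega>) + C * norm w)"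
        using solution_norm_bound[OF elim(2) w] by (simp add: divide_inverse mult.commute)
      finally show ?case by simp
    qed
  qed
qed

section \<open>The error estimate\<close>

theorem theorem3p1:
  fixes M :: "'w measure"
    and a :: "'w \<Rightarrow> 'h::{real_inner, banach, second_countable_topology} \<Rightarrow> 'h \<Rightarrow> real"
    and ell :: "'w \<Rightarrow> 'h \<Rightarrow>\<^sub>L real"
    and K :: "'h set"
    and \<gamma> \<Gamma> :: "'w \<Rightarrow> real" and \<gamma>\<^sub>0 q :: real
    and L :: nat and Tol :: "nat \<Rightarrow> real"
    and S K' :: "nat \<Rightarrow> 'w \<Rightarrow> 'h set" and N :: "nat \<Rightarrow> 'w \<Rightarrow> nat"
    and u :: "'w \<Rightarrow> 'h" and u' ut :: "nat \<Rightarrow> 'w \<Rightarrow> 'h"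
    and m :: "nat \<Rightarrow> nat" and X :: "nat \<Rightarrow> nat \<Rightarrow> 'w \<Rightarrow> 'h"
  assumes prob: "prob_space M" and compl: "complete_measure M"
    and bilin: "\<And>\<omega>. \<omega> \<in> space M \<Longrightarrow> bilinear (a \<omega>)"
    and A1_K: "K \<noteq> {}" "closed K" "convex K"
    and A1_lower: "\<And>\<omega> v. \<omega> \<in> space M \<Longrightarrow> \<gamma> \<omega> * (norm v)\<^sup>2 \<le> a \<omega> v v"
    and A1_upper: "\<And>\<omega> v w. \<omega> \<in> space M \<Longrightarrow> a \<omega> v w \<le> \<Gamma> \<omega> * norm v * norm w"
    and A1_coercive: "\<gamma>\<^sub>0 > 0" "AE \<omega> in M. \<gamma> \<omega> \<ge> \<gamma>\<^sub>0"
    and A1_bounded: "in_Linf M \<Gamma>"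
    and A1_meas_a: "\<And>v w. (\<lambda>\<omega>. a \<omega> v w) \<in> borel_measurable M"
    and A1_meas_ell: "\<And>v. (\<lambda>\<omega>. blinfun_apply (ell \<omega>) v) \<in> borel_measurable M"
    and A1_ell: "in_L2 M ell"
    and u_solves: "AE \<omega> in M. solves_VI (a \<omega>) (ell \<omega>) K (u \<omega>)"
    and L: "L \<ge> 1"
    and Tol1: "0 < Tol 1" "Tol 1 < 1"
    and q: "0 < q" "q < 1"
    and Tol_step: "\<And>l. l \<in> {2..L} \<Longrightarrow> Tol l = q * Tol (l - 1)"
    and S_subspace: "\<And>l \<omega>. l \<in> {1..L} \<Longrightarrow> \<omega> \<in> space M \<Longrightarrow> subspace (S l \<omega>)"
    and S_fin: "\<And>l \<omega>. l \<in> {1..L} \<Longrightarrow> \<omega> \<in> space M \<Longrightarrow> \<exists>B. finite B \<and> span B = S l \<omega>"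
    and S_dim: "\<And>l \<omega>. l \<in> {1..L} \<Longrightarrow> \<omega> \<in> space M \<Longrightarrow> dim (S l \<omega>) = N l \<omega>"
    and S_nested: "\<And>l \<omega>. l \<in> {1..<L} \<Longrightarrow> \<omega> \<in> space M \<Longrightarrow> S l \<omega> \<subseteq> S (Suc l) \<omega>"
    and K'_sub: "\<And>l \<omega>. l \<in> {1..L} \<Longrightarrow> \<omega> \<in> space M \<Longrightarrow> K' l \<omega> \<subseteq> S l \<omega>"
    and K'_set: "\<And>l \<omega>. l \<in> {1..L} \<Longrightarrow> \<omega> \<in> space M \<Longrightarrow>
                   K' l \<omega> \<noteq> {} \<and> closed (K' l \<omega>) \<and> convex (K' l \<omega>)"
    and A2_meas: "\<And>l. l \<in> {1..L} \<Longrightarrow> measurable_set_valued M (K' l)"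
    and A2_sel: "\<And>l. l \<in> {1..L} \<Longrightarrow> \<exists>w. in_L2 M w \<and> (\<forall>\<omega>\<in>space M. w \<omega> \<in> K' l \<omega>)"
    and u'_solves: "\<And>l. l \<in> {1..L} \<Longrightarrow>
                      AE \<omega> in M. solves_VI (a \<omega>) (ell \<omega>) (K' l \<omega>) (u' l \<omega>)"
    and A3: "\<And>l. l \<in> {1..L} \<Longrightarrow> L2_norm M (\<lambda>\<omega>. u \<omega> - u' l \<omega>) \<le> 1 / (2 * sqrt 2) * Tol l"
    and A4_sub: "\<And>l \<omega>. l \<in> {1..L} \<Longrightarrow> \<omega> \<in> space M \<Longrightarrow> ut l \<omega> \<in> S l \<omega>"
    and A4_err: "\<And>l \<omega>. l \<in> {1..L} \<Longrightarrow> \<omega> \<in> space M \<Longrightarrow>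
                   norm (u' l \<omega> - ut l \<omega>) \<le> 1 / (2 * sqrt 2) * Tol l"
    and A4_L2: "\<And>l. l \<in> {1..L} \<Longrightarrow> in_L2 M (ut l)"
    and ut_0: "ut 0 = (\<lambda>_. 0)"
    and m_pos: "\<And>l. l \<in> {1..L} \<Longrightarrow> m l \<ge> 1"
    and copies: "\<And>l. l \<in> {1..L} \<Longrightarrow>
                   iid_copies M (\<lambda>\<omega>. ut l \<omega> - ut (l - 1) \<omega>) (m l) (X l)"
    and levels_indep:
      "prob_space.indep_vars M (\<lambda>_. borel) (\<lambda>l. MC_estimator (m l) (X l)) {1..L}"
  shows "in_L2 M (\<lambda>\<omega>. (\<integral>\<omega>'. u \<omega>' \<partial>M) - MLMC_estimator L m X \<omega>) \<and>
    (L2_norm M (\<lambda>\<omega>. (\<integral>\<omega>'. u \<omega>' \<partial>M) - MLMC_estimator L m X \<omega>))\<^sup>2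
      \<le> 3 * inverse (real (m 1)) * (1 / 4 * (Tol 1)\<^sup>2 + Var M u)
        + 1 / 2 * (1 + (1 + inverse q)\<^sup>2 *
            (\<Sum>l=2..L. inverse (real (m l)) * q powi (2 * (int l - int L)))) * (Tol L)\<^sup>2"
proof -
  interpret prob_space M by fact
  let ?c = "1 / (2 * sqrt 2)"
  have c2: "?c\<^sup>2 = 1 / 8"
    by (simp add: power_divide power_mult_distrib)
  have Tol_pos: "Tol l > 0" if "l \<in> {1..L}" for l
  proof -
    have "1 \<le> l" "l \<le> L" using that by auto
    then show ?thesis
    proof (induction l rule: dec_induct)
      case base
      then show ?case using Tol1 by simp
    next
      case (step n)
      then show ?case using q Tol_step[of "Suc n"] by simp
    qed
  qed

  obtain C0 where "AE \<omega> in M. \<bar>\<Gamma> \<omega>\<bar> \<le> C0"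
    using A1_bounded by (auto simp: in_Linf_def)
  then have C: "AE \<omega> in M. \<Gamma> \<omega> \<le> \<bar>C0\<bar>"
    by eventually_elim auto
  have form: "AE \<omega> in M. coercive_form (a \<omega>) \<gamma>\<^sub>0 \<bar>C0\<bar>"
    using A1_coercive(2) C AE_space
  proof eventually_elim
    case (elim \<omega>)
    show ?case
    proof
      show "bilinear (a \<omega>)" using elim bilin by simp
      show "\<gamma>\<^sub>0 > 0" "\<bar>C0\<bar> \<ge> 0" using A1_coercive by auto
      show "\<gamma>\<^sub>0 * (norm v)\<^sup>2 \<le> a \<omega> v v" for v
        using elim A1_lower[of \<omega> v] mult_right_mono[of "\<gamma>\<^sub>0" "\<gamma> \<omega>" "(norm v)\<^sup>2"] by simp
      show "a \<omega> v w \<le> \<bar>C0\<bar> * norm v * norm w" for v w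
        using elim A1_upper[of \<omega> v w] mult_right_mono[OF elim(2), of "norm v * norm w"]
        by (simp add: mult.assoc)
    qed
  qed
  then have coercive: "AE \<omega> in M. \<gamma>\<^sub>0 > 0 \<and> (\<forall>v. \<gamma>\<^sub>0 * (norm v)\<^sup>2 \<le> a \<omega> v v)"
    by eventually_elim (auto simp: coercive_form_def)
  \<comment> \<open>\<open>L2_norm\<close> of a non-measurable function may be 0, so \<open>A3\<close> carries information only
    once \<open>u\<close> and \<open>u' l\<close> are known to be square-integrable.\<close>
  note meas = random_VI_solution_measurable[OF compl bilin A1_upper coercive A1_meas_a A1_meas_ell]
  have u_meas: "u \<in> borel_measurable M"
  proof (rule meas[OF _ _ _ u_solves])
    have "{\<omega> \<in> space M. P} \<in> sets M" for P
      by (cases P) auto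
    then show "measurable_set_valued M (\<lambda>_. K)"
      by (simp add: measurable_set_valued_def)
  qed
  obtain w where "w \<in> K" using A1_K by auto
  then have u_L2: "in_L2 M u"
    by (intro VI_solution_in_L2[OF finite_measure_axioms form _ A1_ell u_solves u_meas])
  have ud_L2: "in_L2 M (\<lambda>\<omega>. u' l \<omega> - ut l \<omega>)" if l: "l \<in> {1..L}" for l
  proof (rule in_L2_dominated[OF in_L2_const[of "?c * Tol l"]])
    have "u' l \<in> borel_measurable M"
      by (rule meas[OF _ _ A2_meas[OF l] u'_solves[OF l]])
    then show "(\<lambda>\<omega>. u' l \<omega> - ut l \<omega>) \<in> borel_measurable M"
      using A4_L2[OF l] by (auto simp: in_L2_def)
    show "AE \<omega> in M. norm (u' l \<omega> - ut l \<omega>) \<le> norm (?c * Tol l)"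
      using A4_err[OF l] Tol_pos[OF l] by (intro AE_I2) simp
  qed
  have u'_L2: "in_L2 M (u' l)" if l: "l \<in> {1..L}" for l
    using in_L2_add[OF ud_L2[OF l] A4_L2[OF l]] by simp

  have err: "(L2_norm M (\<lambda>\<omega>. u \<omega> - ut l \<omega>))\<^sup>2 \<le> (Tol l)\<^sup>2 / 2" if l: "l \<in> {1..L}" for l
  proof -
    have "(L2_norm M (\<lambda>\<omega>. u \<omega> - u' l \<omega>))\<^sup>2 \<le> (?c * Tol l)\<^sup>2"
      using A3[OF l] by (intro power_mono) (auto simp: L2_norm_def)
    then have 1: "(L2_norm M (\<lambda>\<omega>. u \<omega> - u' l \<omega>))\<^sup>2 \<le> (Tol l)\<^sup>2 / 8"
      unfolding power_mult_distrib c2 by simp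
    have "(L2_norm M (\<lambda>\<omega>. u' l \<omega> - ut l \<omega>))\<^sup>2 \<le> (\<integral>\<omega>. (?c * Tol l)\<^sup>2 \<partial>M)"
      unfolding L2_norm_power2 using A4_err[OF l]
      by (intro integral_mono in_L2_integrable ud_L2 l power_mono) auto
    then have 2: "(L2_norm M (\<lambda>\<omega>. u' l \<omega> - ut l \<omega>))\<^sup>2 \<le> (Tol l)\<^sup>2 / 8"
      unfolding power_mult_distrib c2 by (simp add: prob_space)
    have "(L2_norm M (\<lambda>\<omega>. u \<omega> - ut l \<omega>))\<^sup>2
        \<le> 2 * (L2_norm M (\<lambda>\<omega>. u \<omega> - u' l \<omega>))\<^sup>2 + 2 * (L2_norm M (\<lambda>\<omega>. u' l \<omega> - ut l \<omega>))\<^sup>2"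
      using L2_norm_add_power2_le[OF in_L2_diff[OF u_L2 u'_L2[OF l]] ud_L2[OF l], of 1]
      by simp
    with 1 2 show ?thesis by simp
  qed
  have e_L2: "in_L2 M (\<lambda>\<omega>. u \<omega> - ut l \<omega>)" "in_L2 M (\<lambda>\<omega>. ut l \<omega> - u \<omega>)" if "l \<in> {1..L}" for l
    by (intro in_L2_diff u_L2 A4_L2 that)+
  have err': "(L2_norm M (\<lambda>\<omega>. ut l \<omega> - u \<omega>))\<^sup>2 \<le> (Tol l)\<^sup>2 / 2" if l: "l \<in> {1..L}" for l
    using err[OF l] by (simp add: L2_norm_def norm_minus_commute)

  have bias: "(norm ((\<integral>\<omega>. u \<omega> \<partial>M) - (\<integral>\<omega>. ut L \<omega> \<partial>M)))\<^sup>2 \<le> (Tol L)\<^sup>2 / 2"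
  proof -
    have "(\<integral>\<omega>. u \<omega> \<partial>M) - (\<integral>\<omega>. ut L \<omega> \<partial>M) = (\<integral>\<omega>. u \<omega> - ut L \<omega> \<partial>M)"
      using L by (intro Bochner_Integration.integral_diff[symmetric] in_L2_imp_integrable u_L2 A4_L2) simp
    then show ?thesis
      using norm_expectation_power2_le[OF e_L2(1)[of L]] err[of L] L by (simp add: L2_norm_power2)
  qed
  have var_1: "Var M (\<lambda>\<omega>. ut 1 \<omega> - ut 0 \<omega>) \<le> 3 * (1 / 4 * (Tol 1)\<^sup>2 + Var M u)"
  proof -
    have l: "1 \<in> {1..L}" using L by simp
    have "Var M (\<lambda>\<omega>. ut 1 \<omega> - ut 0 \<omega>) \<le> 3 * Var M u + 3 / 2 * Var M (\<lambda>\<omega>. ut 1 \<omega> - u \<omega>)"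
      \<comment> \<open>The weight 2 gives the factors 3 and 3/2 that the claimed bound requires.\<close>
      using Var_add_le[OF u_L2 e_L2(2)[OF l], of 2] by (simp add: ut_0)
    also have "Var M (\<lambda>\<omega>. ut 1 \<omega> - u \<omega>) \<le> (Tol 1)\<^sup>2 / 2"
      using Var_le[OF e_L2(2)[OF l]] err'[OF l] by (simp add: L2_norm_power2)
    finally show ?thesis by simp
  qed
  have Tol_L: "(Tol l)\<^sup>2 = q powi (2 * (int l - int L)) * (Tol L)\<^sup>2" if l: "l \<in> {1..L}" for l
  proof -
    have "l \<le> L" using l by simp
    then have "Tol L = q ^ (L - l) * Tol l"
    proof (induction rule: dec_induct)
      case (step n)
      then show ?case using Tol_step[of "Suc n"] l by (simp add: Suc_diff_le)
    qed simp
    moreover have "2 * (int l - int L) = - int (2 * (L - l))"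
      using l by simp
    then have "q powi (2 * (int l - int L)) = inverse ((q ^ (L - l))\<^sup>2)"
      by (simp only: power_int_minus power_int_of_nat power_mult[symmetric] mult.commute)
    ultimately show ?thesis
      using q by (simp add: power_mult_distrib)
  qed
  have var_l: "Var M (\<lambda>\<omega>. ut l \<omega> - ut (l - 1) \<omega>)
      \<le> 1 / 2 * (1 + inverse q)\<^sup>2 * (q powi (2 * (int l - int L)) * (Tol L)\<^sup>2)" if l: "l \<in> {2..L}" for l
  proof -
    have l': "l \<in> {1..L}" "l - 1 \<in> {1..L}" using l by auto
    have Tol_prev: "Tol (l - 1) = inverse q * Tol l"
      using Tol_step[OF l] q by simp
    have "Var M (\<lambda>\<omega>. ut l \<omega> - ut (l - 1) \<omega>) \<le> (L2_norm M (\<lambda>\<omega>. ut l \<omega> - ut (l - 1) \<omega>))\<^sup>2"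
      unfolding L2_norm_power2 by (intro Var_le in_L2_diff A4_L2 l')
    also have "\<dots> \<le> (1 + inverse q) * (L2_norm M (\<lambda>\<omega>. ut l \<omega> - u \<omega>))\<^sup>2 +
        (1 + q) * (L2_norm M (\<lambda>\<omega>. u \<omega> - ut (l - 1) \<omega>))\<^sup>2"
      \<comment> \<open>The optimal weight is the ratio of the two error bounds, \<open>Tol (l - 1) / Tol l\<close>.\<close>
      using L2_norm_add_power2_le[OF e_L2(2)[OF l'(1)] e_L2(1)[OF l'(2)], of "inverse q"] q by simp
    also have "\<dots> \<le> (1 + inverse q) * ((Tol l)\<^sup>2 / 2) + (1 + q) * ((Tol (l - 1))\<^sup>2 / 2)"
      using err'[OF l'(1)] err[OF l'(2)] q by (intro add_mono mult_left_mono) auto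
    also have "\<dots> = 1 / 2 * (1 + inverse q)\<^sup>2 * (Tol l)\<^sup>2"
      unfolding Tol_prev using q by (simp add: field_simps power2_eq_square)
    finally show ?thesis unfolding Tol_L[OF l'(1)] .
  qed

  have est_L2: "in_L2 M (\<lambda>\<omega>. (\<integral>\<omega>'. u \<omega>' \<partial>M) - MLMC_estimator L m X \<omega>)"
    by (rule MLMC_estimator_error(1)[OF ut_0 A4_L2 m_pos copies levels_indep])
  have split: "(L2_norm M (\<lambda>\<omega>. (\<integral>\<omega>'. u \<omega>' \<partial>M) - MLMC_estimator L m X \<omega>))\<^sup>2 =
      (norm ((\<integral>\<omega>. u \<omega> \<partial>M) - (\<integral>\<omega>. ut L \<omega> \<partial>M)))\<^sup>2 +
      (\<Sum>l=1..L. inverse (real (m l)) * Var M (\<lambda>\<omega>. ut l \<omega> - ut (l - 1) \<omega>))"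
    unfolding L2_norm_power2
    by (rule MLMC_estimator_error(2)[OF ut_0 A4_L2 m_pos copies levels_indep])
  have "(\<Sum>l=1..L. inverse (real (m l)) * Var M (\<lambda>\<omega>. ut l \<omega> - ut (l - 1) \<omega>)) =
      inverse (real (m 1)) * Var M (\<lambda>\<omega>. ut 1 \<omega> - ut 0 \<omega>) +
      (\<Sum>l=2..L. inverse (real (m l)) * Var M (\<lambda>\<omega>. ut l \<omega> - ut (l - 1) \<omega>))"
    using L by (subst sum.atLeast_Suc_atMost) (simp_all add: numeral_2_eq_2)
  also have "\<dots> \<le> inverse (real (m 1)) * (3 * (1 / 4 * (Tol 1)\<^sup>2 + Var M u)) +
      (\<Sum>l=2..L. inverse (real (m l)) *
        (1 / 2 * (1 + inverse q)\<^sup>2 * (q powi (2 * (int l - int L)) * (Tol L)\<^sup>2)))"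
    by (intro add_mono sum_mono mult_left_mono var_1 var_l) auto
  also have "\<dots> = 3 * inverse (real (m 1)) * (1 / 4 * (Tol 1)\<^sup>2 + Var M u) +
      1 / 2 * ((1 + inverse q)\<^sup>2 *
        (\<Sum>l=2..L. inverse (real (m l)) * q powi (2 * (int l - int L)))) * (Tol L)\<^sup>2"
    by (simp add: sum_distrib_left sum_distrib_right mult_ac)
  finally have "(L2_norm M (\<lambda>\<omega>. (\<integral>\<omega>'. u \<omega>' \<partial>M) - MLMC_estimator L m X \<omega>))\<^sup>2
      \<le> (Tol L)\<^sup>2 / 2 + (3 * inverse (real (m 1)) * (1 / 4 * (Tol 1)\<^sup>2 + Var M u) +
      1 / 2 * ((1 + inverse q)\<^sup>2 *
        (\<Sum>l=2..L. inverse (real (m l)) * q powi (2 * (int l - int L)))) * (Tol L)\<^sup>2)"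
    using split bias by linarith
  then show ?thesis
    using est_L2 by (simp add: algebra_simps)
qed

end
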